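(* Let $h\in\mathcal{P}_2$ and let $x=(x^1,x^2)\in\mathbb{R}\times\Pi$ be a $B$-point for $h$. Then (1) every point of $\{x^1\}\times\Pi^-$ is a $B$-point for $h$; (2) every point of $\{x^1\}\times\Pi$ is a $C$-point for $h$; (3) $h$ is constant on $\{x^1\}\times\Pi^-$ (where $h(y)$ denotes the nontangential limit of $h$ at $y$); (4) the angular gradient $\nabla h$ is constant on $\{x^1\}\times\Pi$, with value $$\nabla h(y)=\begin{pmatrix}\beta\\0\end{pmatrix}\quad\text{for every }y\in\{x^1\}\times\Pi,$$ where $$\beta=\liminf_{z\to x}\frac{\mathrm{Im}\,h(z)}{\mathrm{Im}\,z^1}.$$
   Context: $\Pi=\{z\in\mathbb{C}:\mathrm{Im}\,z>0\}$, and $\Pi^-=\{z\in\mathbb{C}:\mathrm{Im}\,z\ge0\}$ is its closure in $\mathbb{C}$. Superscripts on points of $\mathbb{C}^2$ are coordinate indices: $z=(z^1,z^2)$, and $\|z\|=\max\{|z^1|,|z^2|\}$. The two-variable Pick class $\mathcal{P}_2$ is the set of analytic functions on $\Pi^2$ with non-negative imaginary part. A set $S\subset\Pi^2$ approaches $x\in\partial(\Pi^2)$ nontangentially if $x$ lies in the closure of $S$ and $\|z-x\|/\mathrm{dist}(z,\mathbb{C}^2\setminus\Pi^2)$ is bounded for $z\in S$. A nontangential limit at $x$ is a limit that exists, with the same value, along every set approaching $x$ nontangentially. A point $x\in\partial(\Pi^2)\subset\mathbb{C}^2$ is a $B$-point for $h\in\mathcal{P}_2$ if $\liminf_{z\to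 x}\frac{\mathrm{Im}\,h(z)}{\mathrm{Im}\,z^j}<\infty$ for $j=1,2$ ($z$ ranging over $\Pi^2$). A point $x\in\partial(\Pi^2)$ is a $C$-point for $h$ if for every set $S\subset\Pi^2$ approaching $x$ nontangentially there are $\xi\in\mathbb{R}$ and $\eta^1,\eta^2\in\mathbb{C}$ such that $h(z)=\xi+\eta^1(z^1-x^1)+\eta^2(z^2-x^2)+o(\|z-x\|)$ as $z\to x$ in $S$. These quantities are then the same for every such $S$, and the angular gradient is $\nabla h(x)=\begin{pmatrix}\eta^1\\\eta^2\end{pmatrix}$. *)

theory Defs
  imports "HOL-Analysis.Analysis" "HOL-Library.Landau_Symbols"
begin

text \<open>
  Points of \<open>\<complex>\<^sup>2\<close> are pairs; the paper's superscripts 1 and 2 are \<^const>\<open>fst\<close> and \<^const>\<open>snd\<close>.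
\<close>

definition upper_half_plane :: "complex set"
  where "upper_half_plane = {z. Im z > 0}"

definition closed_upper_half_plane :: "complex set"
  where "closed_upper_half_plane = {z. Im z \<ge> 0}"

definition biplane :: "(complex \<times> complex) set"
  where "biplane = upper_half_plane \<times> upper_half_plane"

text \<open>
  The library norm on a product type is Euclidean, so the maximum norm is introduced separately.
\<close>

definition max_norm :: "complex \<times> complex \<Rightarrow> real"
  where "max_norm z = max (norm (fst z)) (norm (snd z))"

definition dist_to_complement :: "complex \<times> complex \<Rightarrow> real"
  where "dist_to_complement z = (INF w \<in> - biplane. max_norm (z - w))"

text \<open>
  Analyticity in two variables is complex (Frechet) differentiability at every point of the open
  set: the real derivative exists and is complex linear. Nothing is required of the values of
  \<open>h\<close> off the domain.
\<close>

definition pick_class2 :: "(complex \<times> complex \<Rightarrow> complex) set"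
  where "pick_class2 =
    {h. (\<forall>z\<in>biplane. \<exists>a b. (h has_derivative (\<lambda>w. a * fst w + b * snd w)) (at z)) \<and>
        (\<forall>z\<in>biplane. Im (h z) \<ge> 0)}"

definition approaches_nontangentially ::
    "(complex \<times> complex) set \<Rightarrow> complex \<times> complex \<Rightarrow> bool"
  where "approaches_nontangentially S x \<longleftrightarrow>
    x \<in> frontier biplane \<and> S \<subseteq> biplane \<and> x \<in> closure S \<and>
    bounded ((\<lambda>z. max_norm (z - x) / dist_to_complement z) ` S)"

definition has_nontangential_limit ::
    "(complex \<times> complex \<Rightarrow> complex) \<Rightarrow> complex \<times> complex \<Rightarrow> complex \<Rightarrow> bool"
  where "has_nontangential_limit h x l \<longleftrightarrow>
    x \<in> frontier biplane \<and>
    (\<forall>S. approaches_nontangentially S x \<longrightarrow> (h \<longlongrightarrow> l) (at x within S))"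

definition B_point :: "(complex \<times> complex \<Rightarrow> complex) \<Rightarrow> complex \<times> complex \<Rightarrow> bool"
  where "B_point h x \<longleftrightarrow>
    x \<in> frontier biplane \<and>
    Liminf (at x within biplane) (\<lambda>z. ereal (Im (h z) / Im (fst z))) < \<infinity> \<and>
    Liminf (at x within biplane) (\<lambda>z. ereal (Im (h z) / Im (snd z))) < \<infinity>"

definition linear_expansion_on ::
    "(complex \<times> complex) set \<Rightarrow> (complex \<times> complex \<Rightarrow> complex) \<Rightarrow> complex \<times> complex \<Rightarrow>
     real \<Rightarrow> complex \<times> complex \<Rightarrow> bool"
  where "linear_expansion_on S h x \<xi> \<eta> \<longleftrightarrow>
    (\<lambda>z. h z - (of_real \<xi> + fst \<eta> * (fst z - fst x) + snd \<eta> * (snd z - snd x)))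
      \<in> o[at x within S](\<lambda>z. of_real (max_norm (z - x)))"

definition C_point :: "(complex \<times> complex \<Rightarrow> complex) \<Rightarrow> complex \<times> complex \<Rightarrow> bool"
  where "C_point h x \<longleftrightarrow>
    x \<in> frontier biplane \<and>
    (\<forall>S. approaches_nontangentially S x \<longrightarrow> (\<exists>\<xi> \<eta>. linear_expansion_on S h x \<xi> \<eta>))"

text \<open>
  The coefficients are common to all nontangential sets \<open>S\<close>. This quantifier order is essential:
  for a thin \<open>S\<close>, such as a ray, the expansion along \<open>S\<close> alone does not determine \<open>\<eta>\<close>. Taken over
  all \<open>S\<close> (which include full nontangential cones) it does.
\<close>

definition has_angular_gradient ::
    "(complex \<times> complex \<Rightarrow> complex) \<Rightarrow> complex \<times> complex \<Rightarrow> complex \<times> complex \<Rightarrow> bool"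
  where "has_angular_gradient h x \<eta> \<longleftrightarrow>
    C_point h x \<and>
    (\<exists>\<xi>. \<forall>S. approaches_nontangentially S x \<longrightarrow> linear_expansion_on S h x \<xi> \<eta>)"

end

theory Submission
  imports Defs "HOL-Complex_Analysis.Conformal_Mappings"
begin

text \<open>
  The proof rests on one inequality that does not see the second variable. A function of the
  two-variable Pick class contracts the hyperbolic metric: the distance of \<open>h z\<close> and \<open>h w\<close> is
  at most the larger of the two coordinate distances (\<open>schwarz_pick\<close>). Apply this with \<open>w\<close>
  running along a sequence that realises the lower limit \<open>\<beta>\<close> at \<open>x\<close>. Since
  \<open>w\<^sup>1\<close> tends to the real point \<open>x\<^sup>1\<close> and \<open>w\<^sup>2\<close> to the interior point \<open>x\<^sup>2\<close>, the first distance
  tends to infinity and the second stays bounded, so from some index on the maximum is the first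
  one. In the limit, Julia's inequality (\<open>julia_inequality\<close>)
  \<open>\<bar>h z - c\<bar>\<^sup>2 * Im z\<^sup>1 \<le> \<beta> * \<bar>z\<^sup>1 - x\<^sup>1\<bar>\<^sup>2 * Im (h z)\<close>
  holds for some real \<open>c\<close> on the whole of the product domain, whatever \<open>z\<^sup>2\<close> is.

  Hence \<open>Im (h z)\<close> and even \<open>\<bar>h z - c\<bar>\<close> are at most \<open>\<beta> * \<bar>z\<^sup>1 - x\<^sup>1\<bar>\<^sup>2 / Im z\<^sup>1\<close>, which gives
  the \<open>B\<close>-points and the common nontangential limit \<open>c\<close> along the edge \<open>{x\<^sup>1} \<times> \<Pi>\<^sup>-\<close>. It also shows that
  the lower limit of \<open>Im h / Im z\<^sup>1\<close> at any other point \<open>y\<close> of \<open>{x\<^sup>1} \<times> \<Pi>\<close> is at most \<open>\<beta>\<close>;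
  exchanging the roles of \<open>x\<close> and \<open>y\<close>, it equals \<open>\<beta>\<close>.

  For the gradient, this equality is what makes a Julia--Caratheodory argument work at every
  such \<open>y\<close>. Along a diagonal
  ray of height \<open>e\<close> above \<open>y\<close>, the quotient \<open>(h - c) / e\<close> has modulus at most \<open>\<beta>\<close>, while the lower limit of
  its imaginary part is \<open>\<beta>\<close>; so it tends to \<open>\<i> * \<beta>\<close> (\<open>radial_derivative\<close>). To leave the ray, let
  \<open>\<beta> > 0\<close> and put \<open>g z = 1 / (\<beta> * (z\<^sup>1 - x\<^sup>1)) - 1 / (h z - c)\<close>.
  Julia's inequality says exactly that \<open>Im g \<ge> 0\<close>, so \<open>g\<close> is again a Pick function and its size
  is comparable at points of bounded hyperbolic distance. Therefore \<open>(z\<^sup>1 - x\<^sup>1) * g z\<close>,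
  which tends to \<open>0\<close> along the ray, does so nontangentially
  (\<open>residue_limit_nontangential\<close>), and
  \<open>(h z - c) / (z\<^sup>1 - x\<^sup>1) = 1 / (1 / \<beta> - (z\<^sup>1 - x\<^sup>1) * g z)\<close> tends to \<open>\<beta>\<close>. This is the
  expansion with gradient \<open>(\<beta>, 0)\<close>.
\<close>

section \<open>The Schwarz--Pick inequality in two variables\<close>

text \<open>
  An increasing function of the hyperbolic distance \<open>d\<close> of the half-plane, namely
  \<open>2 * (cosh d - 1)\<close>. In terms of it the contraction property is polynomial in \<open>h z\<close> and \<open>h w\<close> and
  stays meaningful when the imaginary parts of the values vanish.
\<close>

definition hyp_ratio :: "complex \<Rightarrow> complex \<Rightarrow> real"
  where "hyp_ratio a b = (cmod (a - b))\<^sup>2 / (Im a * Im b)"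

lemma norm_diff_cnj_sq: "(cmod (b - cnj a))\<^sup>2 = (cmod (b - a))\<^sup>2 + 4 * (Im a * Im b)"
  unfolding cmod_power2 by (simp add: algebra_simps power2_eq_square)

lemma diff_cnj_ne_0: "Im a > 0 \<Longrightarrow> Im b \<ge> 0 \<Longrightarrow> b - cnj a \<noteq> 0"
  by (auto simp: complex_eq_iff)

text \<open>
  The conformal map of the half-plane onto the unit disc that sends \<open>a\<close> to \<open>0\<close>.
\<close>

definition cayley :: "complex \<Rightarrow> complex \<Rightarrow> complex"
  where "cayley a b = (b - a) / (b - cnj a)"

definition inv_cayley :: "complex \<Rightarrow> complex \<Rightarrow> complex"
  where "inv_cayley a \<mu> = (a - cnj a * \<mu>) / (1 - \<mu>)"

lemma norm_cayley_sq:
  assumes "Im a > 0" "Im b > 0"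
  shows "(cmod (cayley a b))\<^sup>2 = hyp_ratio a b / (hyp_ratio a b + 4)"
proof -
  have "(cmod (cayley a b))\<^sup>2 = (cmod (b - a))\<^sup>2 / ((cmod (b - a))\<^sup>2 + 4 * (Im a * Im b))"
    by (simp add: cayley_def norm_divide power_divide norm_diff_cnj_sq)
  also have "\<dots> = hyp_ratio a b / (hyp_ratio a b + 4)"
  proof -
    have "Im a * Im b > 0" using assms by simp
    moreover have "(cmod (b - a))\<^sup>2 \<ge> 0" by simp
    ultimately have "(cmod (b - a))\<^sup>2 + 4 * (Im a * Im b) \<noteq> 0" by linarith
    then show ?thesis using assms
      by (simp add: hyp_ratio_def norm_minus_commute field_simps)
  qed
  finally show ?thesis .
qed

lemma hyp_ratio_nonneg: "Im a > 0 \<Longrightarrow> Im b > 0 \<Longrightarrow> 0 \<le> hyp_ratio a b"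
  by (simp add: hyp_ratio_def)

lemma norm_cayley_less_1:
  assumes "Im a > 0" "Im b > 0"
  shows "cmod (cayley a b) < 1"
proof -
  have "(cmod (cayley a b))\<^sup>2 < 1"
    using norm_cayley_sq[OF assms] hyp_ratio_nonneg[OF assms] by simp
  then show ?thesis by (simp add: power_less_one_iff abs_square_less_1)
qed

lemma inv_cayley_cayley:
  assumes "Im a > 0" "Im b > 0"
  shows "inv_cayley a (cayley a b) = b"
proof -
  have d: "b - cnj a \<noteq> 0" using assms diff_cnj_ne_0 by simp
  have e: "a - cnj a \<noteq> 0" using assms by (auto simp: complex_eq_iff)
  have 1: "a - cnj a * cayley a b = b * (a - cnj a) / (b - cnj a)"
    using d by (simp add: cayley_def field_simps)
  have 2: "1 - cayley a b = (a - cnj a) / (b - cnj a)"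
    using d by (simp add: cayley_def field_simps)
  show ?thesis unfolding inv_cayley_def 1 2 using d e by simp
qed

lemma Im_inv_cayley:
  assumes "Im a > 0" "cmod \<mu> < 1"
  shows "Im (inv_cayley a \<mu>) > 0"
proof -
  have ne: "1 - \<mu> \<noteq> 0" using assms(2) by auto
  have "inv_cayley a \<mu> = (a - cnj a * \<mu>) * cnj (1 - \<mu>) / of_real ((cmod (1 - \<mu>))\<^sup>2)"
    unfolding inv_cayley_def by (subst complex_div_cnj) (simp add: power2_eq_square)
  also have "Im \<dots> = Im ((a - cnj a * \<mu>) * cnj (1 - \<mu>)) / (cmod (1 - \<mu>))\<^sup>2"
    by (simp only: Im_divide_of_real)
  also have "Im ((a - cnj a * \<mu>) * cnj (1 - \<mu>)) = Im a * (1 - (cmod \<mu>)\<^sup>2)"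
    unfolding cmod_power2 by (simp add: algebra_simps power2_eq_square)
  finally have "Im (inv_cayley a \<mu>) = Im a * (1 - (cmod \<mu>)\<^sup>2) / (cmod (1 - \<mu>))\<^sup>2" .
  moreover have "(cmod \<mu>)\<^sup>2 < 1" using assms(2) by (simp add: power_less_one_iff abs_square_less_1)
  ultimately show ?thesis using assms ne by simp
qed

lemma inv_cayley_0 [simp]: "inv_cayley a 0 = a"
  by (simp add: inv_cayley_def)

text \<open>
  The classical one-variable Schwarz lemma applies on an analytic disc through \<open>z\<close> and \<open>w\<close>: in the coordinates of
  the Cayley maps based at \<open>z\<close>, the point \<open>z\<close> is the origin, \<open>w\<close> is some \<open>(r, s)\<close>, and the disc
  is the complex line through both, parametrised so that \<open>w\<close> has parameter \<open>R = max \<bar>r\<bar> \<bar>s\<bar>\<close>.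
\<close>

lemma schwarz_pick_strict:
  assumes h: "h \<in> pick_class2" and pos: "\<And>z. z \<in> biplane \<Longrightarrow> Im (h z) > 0"
    and z: "z \<in> biplane" and w: "w \<in> biplane"
    and Q: "hyp_ratio (fst z) (fst w) \<le> Q" "hyp_ratio (snd z) (snd w) \<le> Q"
  shows "(cmod (h z - h w))\<^sup>2 \<le> Q * (Im (h z) * Im (h w))"
proof -
  define r where "r = cayley (fst z) (fst w)"
  define s where "s = cayley (snd z) (snd w)"
  define R where "R = max (cmod r) (cmod s)"
  have im: "Im (fst z) > 0" "Im (snd z) > 0" "Im (fst w) > 0" "Im (snd w) > 0"
    using z w by (auto simp: biplane_def upper_half_plane_def)
  have Q0: "Q \<ge> 0" using Q(1) hyp_ratio_nonneg[OF im(1,3)] by linarith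
  have mono: "q / (q + 4) \<le> Q / (Q + 4)" if "0 \<le> q" "q \<le> Q" for q
    using that by (simp add: divide_simps) (simp add: algebra_simps)
  have R1: "R < 1" "R \<ge> 0"
    by (auto simp: R_def r_def s_def norm_cayley_less_1 im le_max_iff_disj)
  have "(cmod r)\<^sup>2 \<le> Q / (Q + 4)" "(cmod s)\<^sup>2 \<le> Q / (Q + 4)"
    unfolding r_def s_def
    using mono Q hyp_ratio_nonneg im by (simp_all add: norm_cayley_sq)
  then have R2: "R\<^sup>2 \<le> Q / (Q + 4)" by (simp add: R_def max_def)
  show ?thesis
  proof (cases "R = 0")
    case True
    then have "r = 0" "s = 0" by (auto simp: R_def max_def split: if_splits)
    then have "fst z = fst w" "snd z = snd w"
      using inv_cayley_cayley im unfolding r_def s_def by (metis inv_cayley_0)+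
    then have "z = w" by (simp add: prod_eq_iff)
    then show ?thesis using Q0 pos[OF w] by simp
  next
    case False
    \<comment> \<open>Dividing by the larger modulus keeps both coordinates in the unit disc.\<close>
    define \<phi> where
      "\<phi> t = (inv_cayley (fst z) (r / of_real R * t), inv_cayley (snd z) (s / of_real R * t))" for t
    define f where "f = h \<circ> \<phi>"
    define H where "H t = cayley (f 0) (f t)" for t
    have le: "cmod (r / of_real R) \<le> 1" "cmod (s / of_real R) \<le> 1"
      using False R1 by (auto simp: norm_divide R_def divide_simps)
    have lt: "cmod (r / of_real R * t) < 1" "cmod (s / of_real R * t) < 1" if "cmod t < 1" for t
      using le that by (smt (verit, best) mult_left_le_one_le norm_ge_zero norm_mult)+
    have \<phi>_in: "\<phi> t \<in> biplane" if "cmod t < 1" for t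
      using lt[OF that] im Im_inv_cayley
      by (simp add: \<phi>_def biplane_def upper_half_plane_def)
    have hol1: "(\<lambda>t. inv_cayley a (c * t)) field_differentiable (at t)"
      if "cmod (c * t) < 1" for a c t
    proof -
      have "1 - c * t \<noteq> 0" using that by auto
      then show ?thesis unfolding inv_cayley_def
        by (intro derivative_intros)
    qed
    have f_diff: "f field_differentiable (at t)" if t: "cmod t < 1" for t
    proof -
      obtain a b where d1: "((\<lambda>t. inv_cayley (fst z) (r / of_real R * t)) has_field_derivative a) (at t)"
        and d2: "((\<lambda>t. inv_cayley (snd z) (s / of_real R * t)) has_field_derivative b) (at t)"
        using hol1[OF lt(1)[OF t]] hol1[OF lt(2)[OF t]] unfolding field_differentiable_def by blast
      have dp: "(\<phi> has_derivative (\<lambda>u. (a * u, b * u))) (at t)"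
        unfolding \<phi>_def using d1 d2
        by (intro has_derivative_Pair) (auto simp: has_field_derivative_def)
      obtain A B where "(h has_derivative (\<lambda>w. A * fst w + B * snd w)) (at (\<phi> t))"
        using h \<phi>_in[OF t] unfolding pick_class2_def by blast
      from diff_chain_at[OF dp this]
      have "(f has_derivative (\<lambda>u. (A * a + B * b) * u)) (at t)"
        by (simp add: f_def o_def algebra_simps)
      then show ?thesis unfolding field_differentiable_def has_field_derivative_def by blast
    qed
    have f_pos: "Im (f t) > 0" if "cmod t < 1" for t
      using pos[OF \<phi>_in[OF that]] by (simp add: f_def)
    have H_hol: "H holomorphic_on ball 0 1"
      unfolding holomorphic_on_def
    proof
      fix t :: complex assume "t \<in> ball 0 1"
      then have l: "cmod t < 1" by simp
      have "f t - cnj (f 0) \<noteq> 0" using diff_cnj_ne_0 f_pos[of 0] f_pos[OF l] by simp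
      then have "H field_differentiable (at t)"
        unfolding H_def cayley_def using f_diff[OF l] by (intro derivative_intros) auto
      then show "H field_differentiable (at t within ball 0 1)"
        by (rule field_differentiable_at_within)
    qed
    have "cmod (H (of_real R)) \<le> cmod (of_real R)"
    proof (rule Schwarz_Lemma(1)[OF H_hol])
      show "H 0 = 0" by (simp add: H_def cayley_def)
      show "cmod (H t) < 1" if "cmod t < 1" for t
        unfolding H_def using f_pos[of 0] f_pos[OF that] by (simp add: norm_cayley_less_1)
      show "cmod (complex_of_real R) < 1" using R1 by simp
    qed
    moreover have "f 0 = h z" by (simp add: f_def \<phi>_def)
    moreover have "f (of_real R) = h w"
      using False inv_cayley_cayley im by (simp add: f_def \<phi>_def r_def s_def)
    ultimately have "cmod (cayley (h z) (h w)) \<le> R" using R1 by (simp add: H_def)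
    then have "(cmod (cayley (h z) (h w)))\<^sup>2 \<le> R\<^sup>2" by (rule power_mono) simp
    define q where "q = hyp_ratio (h z) (h w)"
    have q0: "q \<ge> 0" unfolding q_def using pos z w by (simp add: hyp_ratio_nonneg)
    have "q / (q + 4) \<le> Q / (Q + 4)"
      using \<open>(cmod (cayley (h z) (h w)))\<^sup>2 \<le> R\<^sup>2\<close> R2 norm_cayley_sq[of "h z" "h w"] pos z w
      by (simp add: q_def)
    then have "q \<le> Q" using q0 Q0 by (simp add: divide_simps) (simp add: algebra_simps)
    then show ?thesis using pos[OF z] pos[OF w] by (simp add: q_def hyp_ratio_def divide_simps)
  qed
qed

lemma pick_class2_add_const:
  assumes "h \<in> pick_class2" "Im c \<ge> 0"
  shows "(\<lambda>z. h z + c) \<in> pick_class2"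
  using assms has_derivative_add_const[of h _ _ c] unfolding pick_class2_def
  by (fastforce intro!: add_nonneg_nonneg)

text \<open>
  Real values of \<open>h\<close> are reached by applying the strict case to \<open>h + \<i> * e\<close> and letting \<open>e\<close>
  tend to \<open>0\<close>.
\<close>

lemma schwarz_pick:
  assumes h: "h \<in> pick_class2"
    and z: "z \<in> biplane" and w: "w \<in> biplane"
    and Q: "hyp_ratio (fst z) (fst w) \<le> Q" "hyp_ratio (snd z) (snd w) \<le> Q"
  shows "(cmod (h z - h w))\<^sup>2 \<le> Q * (Im (h z) * Im (h w))"
proof (rule tendsto_lowerbound)
  show "((\<lambda>e. Q * ((Im (h z) + e) * (Im (h w) + e))) \<longlongrightarrow> Q * (Im (h z) * Im (h w))) (at_right 0)"
    by (auto intro!: tendsto_eq_intros)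
  have "(cmod (h z - h w))\<^sup>2 \<le> Q * ((Im (h z) + e) * (Im (h w) + e))" if "e > 0" for e
  proof -
    have "(\<lambda>v. h v + \<i> * of_real e) \<in> pick_class2"
      using h that by (intro pick_class2_add_const) auto
    moreover have "Im (h v + \<i> * of_real e) > 0" if "v \<in> biplane" for v
      using h that \<open>e > 0\<close> by (auto simp: pick_class2_def intro: add_nonneg_pos)
    ultimately show ?thesis using schwarz_pick_strict[OF _ _ z w Q] by force
  qed
  then show "\<forall>\<^sub>F e in at_right 0. (cmod (h z - h w))\<^sup>2 \<le> Q * ((Im (h z) + e) * (Im (h w) + e))"
    by (auto simp: eventually_at_filter)
qed simp

section \<open>Approach to the edge\<close>

lemma biplane_iff: "z \<in> biplane \<longleftrightarrow> Im (fst z) > 0 \<and> Im (snd z) > 0"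
  by (auto simp: biplane_def upper_half_plane_def mem_Times_iff)

text \<open>
  Moving both coordinates upwards at the same speed stays in the domain even above a corner
  point, where the second coordinate is real as well, so one ray serves all points of the closed edge.
\<close>

definition diagonal :: "complex \<times> complex \<Rightarrow> real \<Rightarrow> complex \<times> complex"
  where "diagonal y e = (fst y + \<i> * of_real e, snd y + \<i> * of_real e)"

lemma fst_diagonal [simp]: "fst (diagonal y e) = fst y + \<i> * of_real e"
  and snd_diagonal [simp]: "snd (diagonal y e) = snd y + \<i> * of_real e"
  by (simp_all add: diagonal_def)

lemma filterlim_diagonal:
  assumes "Im (fst y) = 0" "Im (snd y) \<ge> 0"
  shows "filterlim (diagonal y) (at y within biplane) (at_right 0)"
  unfolding filterlim_at
proof
  show "\<forall>\<^sub>F e in at_right 0. diagonal y e \<in> biplane \<and> diagonal y e \<noteq> y"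
    using assms by (auto simp: eventually_at_filter biplane_iff prod_eq_iff)
  have "((\<lambda>e. (fst y + \<i> * of_real e, snd y + \<i> * of_real e)) \<longlongrightarrow>
      (fst y + \<i> * of_real 0, snd y + \<i> * of_real 0)) (at_right 0)"
    by (intro tendsto_intros)
  then show "(diagonal y \<longlongrightarrow> y) (at_right 0)"
    by (simp add: diagonal_def[abs_def])
qed

lemma open_biplane: "open biplane"
  unfolding biplane_def upper_half_plane_def
  by (intro open_Times) (simp_all add: open_halfspace_Im_gt)

lemma frontier_biplaneI:
  assumes "Im (fst y) = 0" "Im (snd y) \<ge> 0"
  shows "y \<in> frontier biplane"
proof -
  have lim: "(diagonal y \<longlongrightarrow> y) (at_right 0)"
    using filterlim_diagonal[OF assms] by (simp add: filterlim_at)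
  have "\<forall>\<^sub>F e in at_right 0. diagonal y e \<in> closure biplane"
    using assms
    by (auto simp: eventually_at_filter biplane_iff intro!: always_eventually closure_subset[THEN subsetD])
  from Lim_in_closed_set[OF closed_closure this _ lim] have "y \<in> closure biplane"
    by (simp add: trivial_limit_at_right_real)
  moreover have "y \<notin> biplane" using assms by (simp add: biplane_iff)
  ultimately show ?thesis by (simp add: frontier_def open_biplane interior_open)
qed

section \<open>Julia's inequality\<close>

definition B_quotient :: "(complex \<times> complex \<Rightarrow> complex) \<Rightarrow> complex \<times> complex \<Rightarrow> ereal"
  where "B_quotient h y = Liminf (at y within biplane) (\<lambda>z. ereal (Im (h z) / Im (fst z)))"

lemma Liminf_le_along_diagonal:
  assumes "Im (fst y) = 0" "Im (snd y) \<ge> 0" and "\<And>e. e > 0 \<Longrightarrow> f (diagonal y e) \<le> M"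
  shows "Liminf (at y within biplane) (\<lambda>z. ereal (f z)) \<le> ereal M"
proof (rule ccontr)
  assume "\<not> ?thesis"
  then have "\<forall>\<^sub>F z in at y within biplane. ereal (f z) > ereal M"
    using less_LiminfD not_le by blast
  from eventually_compose_filterlim[OF this filterlim_diagonal[OF assms(1,2)]]
  have "\<forall>\<^sub>F e in at_right 0. f (diagonal y e) > M" by simp
  moreover have "\<forall>\<^sub>F e::real in at_right 0. e > 0" by (simp add: eventually_at_filter)
  ultimately have "\<forall>\<^sub>F e::real in at_right 0. False"
    by eventually_elim (use assms(3) not_le in blast)
  then show False using trivial_limit_at_right_real[of 0] by simp
qed

lemma B_quotient_attained_along_sequence:
  assumes "B_quotient h y \<le> ereal \<beta>"
  obtains Z where "\<And>n. Z n \<in> biplane" "Z \<longlonglongrightarrow> y"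
    "\<And>n. Im (h (Z n)) \<le> (\<beta> + inverse (real (Suc n))) * Im (fst (Z n))"
proof -
  have "\<exists>z. z \<in> biplane \<and> dist z y < inverse (real (Suc n)) \<and>
      Im (h z) \<le> (\<beta> + inverse (real (Suc n))) * Im (fst z)" for n
  proof (rule ccontr)
    assume *: "\<not> ?thesis"
    have "\<forall>\<^sub>F z in at y within biplane. ereal (\<beta> + inverse (real (Suc n))) \<le> ereal (Im (h z) / Im (fst z))"
      unfolding eventually_at
    proof (intro exI[of _ "inverse (real (Suc n))"] conjI ballI impI)
      fix z assume z: "z \<in> biplane" and d: "z \<noteq> y \<and> dist z y < inverse (real (Suc n))"
      have zp: "Im (fst z) > 0" using z by (simp add: biplane_iff)
      have "\<not> Im (h z) \<le> (\<beta> + inverse (real (Suc n))) * Im (fst z)" using * z conjunct2[OF d] by blast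
      then have "(\<beta> + inverse (real (Suc n))) * Im (fst z) \<le> Im (h z)" by (rule less_imp_le[OF not_le[THEN iffD1]])
      then show "ereal (\<beta> + inverse (real (Suc n))) \<le> ereal (Im (h z) / Im (fst z))"
        unfolding ereal_less_eq pos_le_divide_eq[OF zp] .
    qed simp
    then have "ereal (\<beta> + inverse (real (Suc n))) \<le> B_quotient h y"
      unfolding B_quotient_def by (rule Liminf_bounded)
    with assms have "ereal (\<beta> + inverse (real (Suc n))) \<le> ereal \<beta>" by (rule order_trans[rotated])
    then show False by simp
  qed
  then have "\<forall>n. \<exists>z. z \<in> biplane \<and> dist z y < inverse (real (Suc n)) \<and>
      Im (h z) \<le> (\<beta> + inverse (real (Suc n))) * Im (fst z)" by blast
  from choice[OF this] obtain Z where Z: "\<And>n. Z n \<in> biplane"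
    "\<And>n. dist (Z n) y < inverse (real (Suc n))"
    "\<And>n. Im (h (Z n)) \<le> (\<beta> + inverse (real (Suc n))) * Im (fst (Z n))" by blast
  have "(\<lambda>n. dist (Z n) y) \<longlonglongrightarrow> 0"
  proof (rule tendsto_sandwich[OF _ _ tendsto_const LIMSEQ_inverse_real_of_nat])
    show "\<forall>\<^sub>F n in sequentially. dist (Z n) y \<le> inverse (real (Suc n))"
      using less_imp_le[OF Z(2)] by (intro always_eventually allI)
  qed simp
  then have "Z \<longlonglongrightarrow> y" by (rule tendsto_dist_iff[THEN iffD2])
  with Z that show ?thesis by blast
qed

lemma Im_nonneg: "h \<in> pick_class2 \<Longrightarrow> z \<in> biplane \<Longrightarrow> Im (h z) \<ge> 0"
  by (simp add: pick_class2_def)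

text \<open>
  Multiplying out denominators, the contraction property between \<open>z\<close> and a point \<open>Z n\<close> of the
  sequence contains the factor \<open>Im (h (Z n)) / Im (fst (Z n))\<close>, which is controlled by \<open>\<beta>\<close>. The
  same estimate at one fixed \<open>z\<close> shows that the values \<open>h (Z n)\<close> are bounded, and \<open>c\<close> is one of
  their cluster points; it is real because their imaginary parts tend to \<open>0\<close>.
\<close>

lemma julia_inequality:
  assumes h: "h \<in> pick_class2" and y: "Im (fst y) = 0" "Im (snd y) > 0"
    and \<beta>: "B_quotient h y \<le> ereal \<beta>"
  obtains c :: real where
    "\<And>z. z \<in> biplane \<Longrightarrow> (cmod (h z - of_real c))\<^sup>2 * Im (fst z) \<le> \<beta> * (cmod (fst z - fst y))\<^sup>2 * Im (h z)"
proof -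
  obtain Z where Z: "\<And>n. Z n \<in> biplane" and lim: "Z \<longlonglongrightarrow> y"
    and q: "\<And>n. Im (h (Z n)) \<le> (\<beta> + inverse (real (Suc n))) * Im (fst (Z n))"
    using B_quotient_attained_along_sequence[OF \<beta>] by blast
  note lim' = tendsto_fst[OF lim] tendsto_snd[OF lim]
  define \<epsilon> where "\<epsilon> n = inverse (real (Suc n))" for n
  have \<epsilon>: "\<epsilon> \<longlonglongrightarrow> 0" unfolding \<epsilon>_def[abs_def] by (rule LIMSEQ_inverse_real_of_nat)
  note q = q[folded \<epsilon>_def]
  define rhs where "rhs z n = (\<beta> + \<epsilon> n) * (cmod (fst z - fst (Z n)))\<^sup>2 * Im (h z)" for z n
  have rhs_lim: "rhs z \<longlonglongrightarrow> \<beta> * (cmod (fst z - fst y))\<^sup>2 * Im (h z)" for z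
  proof -
    have "rhs z \<longlonglongrightarrow> (\<beta> + 0) * (cmod (fst z - fst y))\<^sup>2 * Im (h z)"
      unfolding rhs_def[abs_def] by (intro tendsto_intros lim' \<epsilon>)
    then show ?thesis by simp
  qed
  have ev: "\<forall>\<^sub>F n in sequentially. (cmod (h z - h (Z n)))\<^sup>2 * Im (fst z) \<le> rhs z n"
    if z: "z \<in> biplane" for z
  proof -
    have zp: "Im (fst z) > 0" "Im (snd z) > 0" using z by (auto simp: biplane_iff)
    \<comment> \<open>Positivity of this difference says that the first coordinates of \<open>z\<close> and \<open>Z n\<close> are
      hyperbolically farther apart than the second ones. Its limit is positive, because
      \<open>Im (fst y) = 0\<close> kills the second term.\<close>
    let ?d = "\<lambda>n. (cmod (fst z - fst (Z n)))\<^sup>2 * (Im (snd z) * Im (snd (Z n)))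
      - (cmod (snd z - snd (Z n)))\<^sup>2 * (Im (fst z) * Im (fst (Z n)))"
    have "?d \<longlonglongrightarrow> (cmod (fst z - fst y))\<^sup>2 * (Im (snd z) * Im (snd y))
      - (cmod (snd z - snd y))\<^sup>2 * (Im (fst z) * Im (fst y))"
      by (intro tendsto_intros lim')
    moreover have "fst z \<noteq> fst y" using zp y by auto
    then have "(cmod (fst z - fst y))\<^sup>2 * (Im (snd z) * Im (snd y))
      - (cmod (snd z - snd y))\<^sup>2 * (Im (fst z) * Im (fst y)) > 0" using zp y by simp
    ultimately have "\<forall>\<^sub>F n in sequentially. ?d n > 0" by (rule order_tendstoD(1))
    then show ?thesis
    proof eventually_elim
      case (elim n)
      have np: "Im (fst (Z n)) > 0" "Im (snd (Z n)) > 0" using Z[of n] by (auto simp: biplane_iff)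
      have "hyp_ratio (snd z) (snd (Z n)) \<le> hyp_ratio (fst z) (fst (Z n))"
        using elim zp np unfolding hyp_ratio_def by (simp add: divide_simps)
      from schwarz_pick[OF h z Z order_refl this]
      have "(cmod (h z - h (Z n)))\<^sup>2 * Im (fst z) * Im (fst (Z n))
        \<le> (cmod (fst z - fst (Z n)))\<^sup>2 * Im (h z) * Im (h (Z n))"
        using zp np unfolding hyp_ratio_def by (simp add: divide_simps mult_ac)
      also have "\<dots> \<le> (cmod (fst z - fst (Z n)))\<^sup>2 * Im (h z)
          * ((\<beta> + \<epsilon> n) * Im (fst (Z n)))"
        by (rule mult_left_mono[OF q]) (simp add: Im_nonneg[OF h z])
      also have "\<dots> = rhs z n * Im (fst (Z n))" by (simp add: rhs_def mult_ac)
      finally show ?case using np by simp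
    qed
  qed
  have i: "(\<i>, \<i>) \<in> biplane" by (simp add: biplane_iff)
  have "Bseq (\<lambda>n. h (Z n))"
  proof -
    from rhs_lim[of "(\<i>, \<i>)"] obtain B where B: "\<And>n. \<bar>rhs (\<i>, \<i>) n\<bar> \<le> B"
      using convergent_imp_Bseq convergentI BseqE by (metis real_norm_def)
    have "\<forall>\<^sub>F n in sequentially. norm (h (Z n)) \<le> norm (h (\<i>, \<i>)) + (1 + B)"
      using ev[OF i]
    proof eventually_elim
      case (elim n)
      let ?d = "cmod (h (\<i>, \<i>) - h (Z n))"
      have "?d\<^sup>2 \<le> B" using elim B[of n] by simp
      moreover have "2 * ?d \<le> 1 + ?d\<^sup>2" using sum_squares_bound[of 1 ?d] by simp
      then have "?d \<le> 1 + ?d\<^sup>2" using norm_ge_zero[of "h (\<i>, \<i>) - h (Z n)"] by linarith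
      moreover have "norm (h (Z n)) \<le> norm (h (\<i>, \<i>)) + ?d" by (rule norm_triangle_sub[of "h (Z n)" "h (\<i>,\<i>)", unfolded norm_minus_commute[of "h (Z n)"]])
      ultimately show ?case by linarith
    qed
    then show ?thesis by (rule BfunI)
  qed
  then have "bounded (range (\<lambda>n. h (Z n)))" by (simp add: Bseq_eq_bounded)
  then obtain l r where r: "strict_mono (r :: nat \<Rightarrow> nat)" and l: "(\<lambda>n. h (Z (r n))) \<longlonglongrightarrow> l"
    using bounded_imp_convergent_subsequence unfolding o_def by blast
  have "Im l = 0"
  proof -
    have "(\<lambda>n. Im (h (Z n))) \<longlonglongrightarrow> 0"
    proof (rule tendsto_sandwich[OF _ _ tendsto_const])
      show "\<forall>\<^sub>F n in sequentially. 0 \<le> Im (h (Z n))" using Im_nonneg[OF h Z] by simp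
      show "\<forall>\<^sub>F n in sequentially. Im (h (Z n)) \<le> (\<beta> + \<epsilon> n) * Im (fst (Z n))"
        using q by simp
      show "(\<lambda>n. (\<beta> + \<epsilon> n) * Im (fst (Z n))) \<longlonglongrightarrow> 0"
      proof -
        have "(\<lambda>n. (\<beta> + \<epsilon> n) * Im (fst (Z n))) \<longlonglongrightarrow> (\<beta> + 0) * Im (fst y)"
          by (intro tendsto_intros lim' \<epsilon>)
        then show ?thesis using y by simp
      qed
    qed
    from LIMSEQ_subseq_LIMSEQ[OF this r] have "(\<lambda>n. Im (h (Z (r n)))) \<longlonglongrightarrow> 0" by (simp add: o_def)
    then show ?thesis using LIMSEQ_unique tendsto_Im[OF l] by blast
  qed
  then have l_eq: "l = of_real (Re l)" by (simp add: complex_eq_iff)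
  show thesis
  proof
    fix z assume z: "z \<in> biplane"
    show "(cmod (h z - of_real (Re l)))\<^sup>2 * Im (fst z) \<le> \<beta> * (cmod (fst z - fst y))\<^sup>2 * Im (h z)"
    proof (rule tendsto_le)
      show "(\<lambda>n. rhs z (r n)) \<longlonglongrightarrow> \<beta> * (cmod (fst z - fst y))\<^sup>2 * Im (h z)"
        using LIMSEQ_subseq_LIMSEQ[OF rhs_lim r] by (simp add: o_def)
      show "(\<lambda>n. (cmod (h z - h (Z (r n))))\<^sup>2 * Im (fst z)) \<longlonglongrightarrow> (cmod (h z - of_real (Re l)))\<^sup>2 * Im (fst z)"
        unfolding l_eq[symmetric] by (intro tendsto_intros l)
      show "\<forall>\<^sub>F n in sequentially. (cmod (h z - h (Z (r n))))\<^sup>2 * Im (fst z) \<le> rhs z (r n)"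
        using ev[OF z] r by (rule eventually_subseq[rotated])
    qed simp
  qed
qed

text \<open>
  Since \<open>c\<close> is real, \<open>Im (h z) \<le> \<bar>h z - c\<bar>\<close>, so one factor \<open>\<bar>h z - c\<bar>\<close> cancels.
\<close>

lemma julia_inequality_bounds:
  assumes z: "z \<in> biplane" and \<beta>: "\<beta> \<ge> 0"
    and le: "(cmod (h z - of_real c))\<^sup>2 * Im (fst z) \<le> \<beta> * (cmod (fst z - p))\<^sup>2 * Im (h z)"
  shows "cmod (h z - of_real c) * Im (fst z) \<le> \<beta> * (cmod (fst z - p))\<^sup>2"
    and "Im (h z) * Im (fst z) \<le> \<beta> * (cmod (fst z - p))\<^sup>2"
proof -
  let ?k = "cmod (h z - of_real c)"
  have "\<bar>Im (h z - of_real c)\<bar> \<le> ?k" by (rule abs_Im_le_cmod)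
  then have Im_le: "Im (h z) \<le> ?k" by simp
  have zp: "Im (fst z) > 0" using z by (simp add: biplane_iff)
  show 1: "?k * Im (fst z) \<le> \<beta> * (cmod (fst z - p))\<^sup>2"
  proof (cases "?k = 0")
    case False
    then have kp: "?k > 0" by (simp add: less_le)
    have "?k * (?k * Im (fst z)) \<le> \<beta> * (cmod (fst z - p))\<^sup>2 * ?k"
      using le Im_le mult_left_mono[OF Im_le, of "\<beta> * (cmod (fst z - p))\<^sup>2"] \<beta>
      by (simp add: power2_eq_square mult_ac)
    then show ?thesis using kp by (simp add: mult.commute)
  qed (use \<beta> in simp)
  show "Im (h z) * Im (fst z) \<le> \<beta> * (cmod (fst z - p))\<^sup>2"
    using mult_right_mono[OF Im_le, of "Im (fst z)"] 1 zp by linarith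
qed

lemma B_quotient_nonneg:
  assumes "h \<in> pick_class2"
  shows "0 \<le> B_quotient h y"
  unfolding B_quotient_def
  using Im_nonneg[OF assms] by (intro Liminf_bounded) (auto simp: eventually_at_filter biplane_iff)

text \<open>
  On the diagonal ray the bound reads \<open>Im h \<le> \<beta> * e\<close>, and both coordinates have imaginary part at
  least \<open>e\<close> there.
\<close>

lemma Liminf_le_of_julia_bound:
  assumes y: "Im (fst y) = 0" "Im (snd y) \<ge> 0" and \<beta>: "\<beta> \<ge> 0"
    and le: "\<And>z. z \<in> biplane \<Longrightarrow> Im (h z) * Im (fst z) \<le> \<beta> * (cmod (fst z - fst y))\<^sup>2"
  shows "B_quotient h y \<le> ereal \<beta>"
    and "Liminf (at y within biplane) (\<lambda>z. ereal (Im (h z) / Im (snd z))) \<le> ereal \<beta>"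
proof -
  have *: "Im (h (diagonal y e)) \<le> \<beta> * e" if "e > 0" for e
  proof -
    have "diagonal y e \<in> biplane" using y that by (simp add: biplane_iff)
    from le[OF this] show ?thesis using y that by (simp add: norm_mult power2_eq_square)
  qed
  then show "B_quotient h y \<le> ereal \<beta>"
    unfolding B_quotient_def using y by (intro Liminf_le_along_diagonal) (auto simp: divide_simps)
  have "Im (h (diagonal y e)) \<le> \<beta> * (Im (snd y) + e)" if "e > 0" for e
    using *[OF that] mult_nonneg_nonneg[OF \<beta> y(2)] by (simp add: distrib_left)
  then show "Liminf (at y within biplane) (\<lambda>z. ereal (Im (h z) / Im (snd z))) \<le> ereal \<beta>"
    using y by (intro Liminf_le_along_diagonal) (auto simp: pos_divide_le_eq)
qed

text \<open>
  The roles of \<open>y\<close> and \<open>y'\<close> can be exchanged once both quotients are finite, so this is an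
  equality along the open edge.
\<close>

lemma B_quotient_le_of_same_fst:
  assumes h: "h \<in> pick_class2" and y: "Im (fst y) = 0" "Im (snd y) > 0" "Im (snd y') > 0"
    and eq: "fst y' = fst y" and \<beta>: "B_quotient h y = ereal \<beta>"
  shows "B_quotient h y' \<le> B_quotient h y"
proof -
  have \<beta>0: "\<beta> \<ge> 0" using B_quotient_nonneg[OF h, of y] \<beta> by simp
  obtain c where c: "\<And>z. z \<in> biplane \<Longrightarrow>
      (cmod (h z - of_real c))\<^sup>2 * Im (fst z) \<le> \<beta> * (cmod (fst z - fst y))\<^sup>2 * Im (h z)"
    using julia_inequality[OF h y(1,2)] \<beta> by (metis order_refl)
  show ?thesis unfolding \<beta>
    using y \<beta>0 eq julia_inequality_bounds(2)[where h=h and c=c, OF _ \<beta>0 c] by (intro Liminf_le_of_julia_bound) auto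
qed

section \<open>Nontangential limits\<close>

lemma dist_to_complement_le:
  assumes "z \<in> biplane"
  shows "dist_to_complement z \<le> Im (fst z)"
proof -
  let ?w = "(of_real (Re (fst z)), snd z)"
  have "dist_to_complement z \<le> max_norm (z - ?w)"
    unfolding dist_to_complement_def
    by (rule cINF_lower) (auto intro!: bdd_belowI[of _ 0] simp: biplane_iff max_norm_def le_max_iff_disj)
  also have "\<dots> = Im (fst z)"
  proof -
    have "fst z - of_real (Re (fst z)) = \<i> * of_real (Im (fst z))" by (simp add: complex_eq_iff)
    then show ?thesis using assms by (simp add: max_norm_def biplane_iff norm_mult)
  qed
  finally show ?thesis .
qed

lemma dist_to_complement_pos:
  assumes "z \<in> biplane"
  shows "dist_to_complement z > 0"
proof -
  have "min (Im (fst z)) (Im (snd z)) \<le> dist_to_complement z"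
    unfolding dist_to_complement_def
  proof (rule cINF_greatest)
    have "(0, 0) \<in> - biplane" by (simp add: biplane_iff)
    then show "- biplane \<noteq> {}" by blast
    fix w assume "w \<in> - biplane"
    then have "Im (fst w) \<le> 0 \<or> Im (snd w) \<le> 0" by (auto simp: biplane_iff not_less)
    then show "min (Im (fst z)) (Im (snd z)) \<le> max_norm (z - w)"
      using abs_Im_le_cmod[of "fst z - fst w"] abs_Im_le_cmod[of "snd z - snd w"]
      by (auto simp: max_norm_def)
  qed
  then show ?thesis using assms by (auto simp: biplane_iff)
qed

text \<open>
  Nontangential approach enters only through this comparison with the height of the first
  coordinate. At a corner point it is weaker than nontangential approach, but sufficient.
\<close>

lemma nontangential_bound:
  assumes "approaches_nontangentially S y"
  obtains C where "C > 0" "\<And>z. z \<in> S \<Longrightarrow> z \<in> biplane"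
    "\<And>z. z \<in> S \<Longrightarrow> max_norm (z - y) \<le> C * Im (fst z)"
proof -
  obtain C where C: "C > 0" "\<And>z. z \<in> S \<Longrightarrow> \<bar>max_norm (z - y) / dist_to_complement z\<bar> \<le> C"
    using assms unfolding approaches_nontangentially_def bounded_pos by auto
  have S: "z \<in> biplane" if "z \<in> S" for z
    using assms that unfolding approaches_nontangentially_def by blast
  show thesis
  proof
    show "C > 0" by fact
    show "z \<in> biplane" if "z \<in> S" for z using S that .
    fix z assume z: "z \<in> S"
    have "max_norm (z - y) / dist_to_complement z \<le> C" using C(2)[OF z] by linarith
    then have "max_norm (z - y) \<le> C * dist_to_complement z"
      using dist_to_complement_pos[OF S[OF z]] by (simp add: pos_divide_le_eq)
    also have "\<dots> \<le> C * Im (fst z)"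
      using dist_to_complement_le[OF S[OF z]] C(1) by simp
    finally show "max_norm (z - y) \<le> C * Im (fst z)" .
  qed
qed

text \<open>
  On a nontangential set \<open>cmod (fst z - fst y) \<le> C * Im (fst z)\<close>, so the hypothesis, which is
  quadratic in \<open>fst z - fst y\<close>, becomes the linear bound \<open>cmod (h z - c) \<le> \<beta> * C * cmod (fst z - fst y)\<close>.
\<close>

lemma nontangential_limit:
  assumes y: "Im (fst y) = 0" "Im (snd y) \<ge> 0" and \<beta>: "\<beta> \<ge> 0"
    and bound: "\<And>z. z \<in> biplane \<Longrightarrow>
      cmod (h z - of_real c) * Im (fst z) \<le> \<beta> * (cmod (fst z - fst y))\<^sup>2"
  shows "has_nontangential_limit h y (of_real c)"
  unfolding has_nontangential_limit_def
proof (intro conjI allI impI)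
  show "y \<in> frontier biplane" using y by (rule frontier_biplaneI)
  fix S assume S: "approaches_nontangentially S y"
  obtain C where C: "C > 0" and SB: "\<And>z. z \<in> S \<Longrightarrow> z \<in> biplane"
    and SC: "\<And>z. z \<in> S \<Longrightarrow> max_norm (z - y) \<le> C * Im (fst z)"
    using nontangential_bound[OF S] by blast
  have "((\<lambda>z. h z - of_real c) \<longlongrightarrow> 0) (at y within S)"
  proof (rule Lim_null_comparison)
    have "((\<lambda>z. \<beta> * C * cmod (fst z - fst y)) \<longlongrightarrow> \<beta> * C * cmod (fst y - fst y)) (at y within S)"
      by (intro tendsto_intros tendsto_fst[OF tendsto_ident_at])
    then show "((\<lambda>z. \<beta> * C * cmod (fst z - fst y)) \<longlongrightarrow> 0) (at y within S)" by simp
    have "norm (h z - of_real c) \<le> \<beta> * C * cmod (fst z - fst y)" if z: "z \<in> S" for z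
    proof -
      have d: "Im (fst z) > 0" using SB[OF z] by (simp add: biplane_iff)
      have "cmod (fst z - fst y) \<le> C * Im (fst z)" using SC[OF z] by (simp add: max_norm_def)
      then have "\<beta> * (cmod (fst z - fst y))\<^sup>2 \<le> \<beta> * (cmod (fst z - fst y) * (C * Im (fst z)))"
        unfolding power2_eq_square using \<beta> by (intro mult_left_mono) auto
      with bound[OF SB[OF z]]
      have "cmod (h z - of_real c) * Im (fst z) \<le> (\<beta> * C * cmod (fst z - fst y)) * Im (fst z)"
        by (simp add: mult_ac)
      then show ?thesis using d by simp
    qed
    then show "\<forall>\<^sub>F z in at y within S. norm (h z - of_real c) \<le> \<beta> * C * cmod (fst z - fst y)"
      by (auto simp: eventually_at_filter)
  qed
  then show "(h \<longlongrightarrow> of_real c) (at y within S)" by (simp add: LIM_zero_iff)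
qed

section \<open>The angular gradient\<close>

text \<open>
  The quotient lies in the disc of radius \<open>\<beta>\<close>, and its imaginary part is eventually larger than
  any number below \<open>\<beta>\<close>. The part of the disc where this holds shrinks to the point \<open>\<i> * \<beta>\<close>.
\<close>

lemma radial_derivative:
  assumes h: "h \<in> pick_class2" and y: "Im (fst y) = 0" "Im (snd y) \<ge> 0"
    and \<beta>: "B_quotient h y = ereal \<beta>"
    and julia: "\<And>z. z \<in> biplane \<Longrightarrow>
      cmod (h z - of_real c) * Im (fst z) \<le> \<beta> * (cmod (fst z - fst y))\<^sup>2"
  shows "((\<lambda>e. (h (diagonal y e) - of_real c) / of_real e) \<longlongrightarrow> \<i> * of_real \<beta>) (at_right 0)"
proof -
  define u where "u e = (h (diagonal y e) - of_real c) / of_real e" for e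
  have \<beta>0: "\<beta> \<ge> 0" using B_quotient_nonneg[OF h, of y] \<beta> by simp
  have Im_u: "Im (u e) = Im (h (diagonal y e)) / e" for e
    by (simp add: u_def)
  have u_le: "cmod (u e) \<le> \<beta>" if "e > 0" for e
  proof -
    have "diagonal y e \<in> biplane" using y that by (simp add: biplane_iff)
    from julia[OF this] have "cmod (h (diagonal y e) - of_real c) \<le> \<beta> * e"
      using y that by (simp add: norm_mult power2_eq_square)
    then show ?thesis using that by (simp add: u_def norm_divide pos_divide_le_eq)
  qed
  have ev_pos: "\<forall>\<^sub>F e::real in at_right 0. e > 0" by (simp add: eventually_at_filter)
  have Im_lim: "((\<lambda>e. Im (u e)) \<longlongrightarrow> \<beta>) (at_right 0)"
  proof (rule order_tendstoI)
    fix b assume "b < \<beta>"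
    then have "ereal b < Liminf (at y within biplane) (\<lambda>z. ereal (Im (h z) / Im (fst z)))"
      using \<beta> by (simp add: B_quotient_def)
    from eventually_compose_filterlim[OF less_LiminfD[OF this] filterlim_diagonal[OF y]]
    show "\<forall>\<^sub>F e in at_right 0. b < Im (u e)" using y by (simp add: Im_u)
  next
    fix b assume b: "\<beta> < b"
    show "\<forall>\<^sub>F e in at_right 0. Im (u e) < b"
      using ev_pos
    proof eventually_elim
      case (elim e)
      then show ?case using u_le[OF elim] abs_Im_le_cmod[of "u e"] b by linarith
    qed
  qed
  have sq: "(cmod (u e - \<i> * of_real \<beta>))\<^sup>2 \<le> 2 * \<beta> * (\<beta> - Im (u e))" if "e > 0" for e
  proof -
    have "(cmod (u e))\<^sup>2 \<le> \<beta>\<^sup>2" using u_le[OF that] by (rule power_mono) simp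
    moreover have "(cmod (u e - \<i> * of_real \<beta>))\<^sup>2 = (cmod (u e))\<^sup>2 - 2 * \<beta> * Im (u e) + \<beta>\<^sup>2"
      unfolding cmod_power2 by (simp add: algebra_simps power2_eq_square)
    ultimately show ?thesis by (simp add: algebra_simps power2_eq_square)
  qed
  have "((\<lambda>e. (cmod (u e - \<i> * of_real \<beta>))\<^sup>2) \<longlongrightarrow> 0) (at_right 0)"
  proof (rule tendsto_sandwich[OF _ _ tendsto_const])
    show "((\<lambda>e. 2 * \<beta> * (\<beta> - Im (u e))) \<longlongrightarrow> 0) (at_right 0)"
    proof -
      have "((\<lambda>e. 2 * \<beta> * (\<beta> - Im (u e))) \<longlongrightarrow> 2 * \<beta> * (\<beta> - \<beta>)) (at_right 0)"
        by (intro tendsto_intros Im_lim)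
      then show ?thesis by simp
    qed
    show "\<forall>\<^sub>F e in at_right 0. (cmod (u e - \<i> * of_real \<beta>))\<^sup>2 \<le> 2 * \<beta> * (\<beta> - Im (u e))"
      using ev_pos by eventually_elim (rule sq)
  qed simp
  from tendsto_real_sqrt[OF this] have "((\<lambda>e. cmod (u e - \<i> * of_real \<beta>)) \<longlongrightarrow> 0) (at_right 0)"
    by simp
  then have "(u \<longlongrightarrow> \<i> * of_real \<beta>) (at_right 0)"
    by (simp add: tendsto_norm_zero_iff LIM_zero_iff)
  then show ?thesis by (simp add: u_def[abs_def])
qed

text \<open>
  An open mapping principle: the Schwarz--Pick inequality forces \<open>h\<close> to be constant as soon as it takes a real
  value.
\<close>

lemma eq_if_real_value:
  assumes h: "h \<in> pick_class2" and z: "z \<in> biplane" and w: "w \<in> biplane" and real: "Im (h z) = 0"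
  shows "h w = h z"
  using schwarz_pick[OF h z w max.cobounded1 max.cobounded2] real by simp

text \<open>
  The map \<open>v \<mapsto> - 1 / v\<close> turns the horodisc of Julia's inequality into a half-plane. For \<open>\<beta>\<close>
  the lower limit of \<open>Im h / Im (fst z)\<close>, the quotient removes from \<open>- 1 / (h z - c)\<close> the
  largest multiple of the pole \<open>- 1 / (fst z - p)\<close> that leaves a Pick function.
\<close>

definition julia_quotient :: "(complex \<times> complex \<Rightarrow> complex) \<Rightarrow> real \<Rightarrow> complex \<Rightarrow> real \<Rightarrow> complex \<times> complex \<Rightarrow> complex"
  where "julia_quotient h c p \<beta> z = 1 / (of_real \<beta> * (fst z - p)) - 1 / (h z - of_real c)"

lemma julia_quotient_in_pick_class2:
  assumes h: "h \<in> pick_class2" and p: "Im p = 0" and \<beta>: "\<beta> > 0"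
    and ne: "\<And>z. z \<in> biplane \<Longrightarrow> h z \<noteq> of_real c"
    and julia: "\<And>z. z \<in> biplane \<Longrightarrow>
      (cmod (h z - of_real c))\<^sup>2 * Im (fst z) \<le> \<beta> * (cmod (fst z - p))\<^sup>2 * Im (h z)"
  shows "julia_quotient h c p \<beta> \<in> pick_class2"
  unfolding pick_class2_def
proof (intro CollectI conjI ballI)
  fix z assume z: "z \<in> biplane"
  have zp: "fst z \<noteq> p" using z p by (auto simp: biplane_iff)
  obtain A B where "(h has_derivative (\<lambda>w. A * fst w + B * snd w)) (at z)"
    using h z unfolding pick_class2_def by blast
  moreover define k where "k = h z - of_real c"
  moreover define \<zeta> where "\<zeta> = of_real \<beta> * (fst z - p)"
  moreover have "k \<noteq> 0" "\<zeta> \<noteq> 0" using ne[OF z] zp \<beta> by (auto simp: k_def \<zeta>_def)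
  ultimately have "((\<lambda>z. inverse (of_real \<beta> * (fst z - p)) - inverse (h z - of_real c)) has_derivative
      (\<lambda>w. - (inverse \<zeta> * (of_real \<beta> * fst w) * inverse \<zeta>)
        - - (inverse k * (A * fst w + B * snd w) * inverse k))) (at z)"
    by (auto intro!: derivative_eq_intros)
  also have "(\<lambda>w. - (inverse \<zeta> * (of_real \<beta> * fst w) * inverse \<zeta>)
        - - (inverse k * (A * fst w + B * snd w) * inverse k))
      = (\<lambda>w. (inverse k * A * inverse k - inverse \<zeta> * of_real \<beta> * inverse \<zeta>) * fst w
          + (inverse k * B * inverse k) * snd w)"
    by (simp add: algebra_simps)
  finally have "(julia_quotient h c p \<beta> has_derivative \<dots>) (at z)"
    by (simp add: julia_quotient_def[abs_def] inverse_eq_divide)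
  then show "\<exists>a b. (julia_quotient h c p \<beta> has_derivative (\<lambda>w. a * fst w + b * snd w)) (at z)"
    by blast
  have Im1: "Im (1 / k) = - Im k / (cmod k)\<^sup>2" for k
    by (simp add: Im_divide cmod_power2)
  have pos: "(cmod (h z - of_real c))\<^sup>2 > 0" "(cmod (fst z - p))\<^sup>2 > 0" using ne[OF z] zp by auto
  have "Im (julia_quotient h c p \<beta> z)
      = Im (h z) / (cmod (h z - of_real c))\<^sup>2 - Im (fst z) / (\<beta> * (cmod (fst z - p))\<^sup>2)"
    unfolding julia_quotient_def minus_complex.sel Im1
    using \<beta> p by (simp add: norm_mult power_mult_distrib power2_eq_square)
  also have "\<dots> \<ge> 0" using julia[OF z] pos \<beta> by (simp add: divide_simps mult_ac)
  finally show "Im (julia_quotient h c p \<beta> z) \<ge> 0" .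
qed

text \<open>
  A Harnack inequality for the modulus: with \<open>t = \<bar>a - b\<bar>\<close>, the hypothesis gives
  \<open>t\<^sup>2 \<le> Q * \<bar>a\<bar> * (\<bar>a\<bar> + t)\<close>, which is impossible for \<open>t > (Q + 1) * \<bar>a\<bar>\<close>.
\<close>

lemma norm_le_of_schwarz_pick:
  assumes "(cmod (a - b))\<^sup>2 \<le> Q * (Im a * Im b)" "Im a \<ge> 0" "Im b \<ge> 0" "Q \<ge> 0"
  shows "cmod b \<le> (Q + 2) * cmod a"
proof -
  define t where "t = cmod (a - b)"
  have b: "cmod b \<le> cmod a + t" unfolding t_def by (metis norm_minus_commute norm_triangle_sub add.commute)
  have "Im a * Im b \<le> cmod a * cmod b"
    using assms abs_Im_le_cmod[of a] abs_Im_le_cmod[of b] by (intro mult_mono) auto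
  also have "\<dots> \<le> cmod a * (cmod a + t)" using b by (intro mult_left_mono) auto
  finally have "Q * (Im a * Im b) \<le> Q * (cmod a * (cmod a + t))" using assms(4) by (rule mult_left_mono)
  with assms(1) have t2: "t\<^sup>2 \<le> Q * (cmod a * (cmod a + t))" by (simp add: t_def)
  have "t \<le> (Q + 1) * cmod a"
  proof (rule ccontr)
    assume "\<not> ?thesis"
    then have gt: "(Q + 1) * cmod a < t" by simp
    have Qa: "0 \<le> Q * cmod a" using assms(4) by simp
    then have tpos: "t > 0" and le: "Q * cmod a \<le> t"
      using gt norm_ge_zero[of a] unfolding distrib_right by linarith+
    have "t * ((Q + 1) * cmod a) < t * t" using gt tpos by simp
    moreover have "cmod a * (Q * cmod a) \<le> cmod a * t" using le by (rule mult_left_mono) simp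
    ultimately show False using t2 by (simp add: algebra_simps power2_eq_square)
  qed
  then show ?thesis using b by (simp add: algebra_simps)
qed

text \<open>
  In one variable, the limit in question is minus the mass at \<open>y\<close> of the measure that represents the
  Pick function \<open>g\<close>. A point \<open>z\<close> of a nontangential set is compared with the point \<open>D z\<close> of the
  ray at the same height: in the first coordinate their hyperbolic distance is bounded by the aperture
  \<open>C\<close>, in the second coordinate it tends to \<open>0\<close> because \<open>snd y\<close> is an interior point.
\<close>

lemma residue_limit_nontangential:
  assumes g: "g \<in> pick_class2" and y: "Im (fst y) = 0" "Im (snd y) > 0"
    and S: "approaches_nontangentially S y"
    and radial: "((\<lambda>e. of_real e * g (diagonal y e)) \<longlongrightarrow> 0) (at_right 0)"
  shows "((\<lambda>z. (fst z - fst y) * g z) \<longlongrightarrow> 0) (at y within S)"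
proof -
  obtain C where C: "C > 0" and SB: "\<And>z. z \<in> S \<Longrightarrow> z \<in> biplane"
    and SC: "\<And>z. z \<in> S \<Longrightarrow> max_norm (z - y) \<le> C * Im (fst z)"
    using nontangential_bound[OF S] by blast
  define D where "D z = diagonal y (Im (fst z))" for z :: "complex \<times> complex"
  define Q where "Q = (C + 1)\<^sup>2"
  have Q1: "Q > 1" using C by (simp add: Q_def one_less_power)
  note lims = tendsto_fst[OF tendsto_ident_at] tendsto_snd[OF tendsto_ident_at]
  have ev_S: "\<forall>\<^sub>F z in at y within S. z \<in> S" by (simp add: eventually_at_filter)
  have Im_lim: "filterlim (\<lambda>z. Im (fst z)) (at_right 0) (at y within S)"
  proof (rule filterlim_at[THEN iffD2], rule conjI)
    show "\<forall>\<^sub>F z in at y within S. Im (fst z) \<in> {0<..} \<and> Im (fst z) \<noteq> 0"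
      using ev_S by eventually_elim (use SB in \<open>force simp: biplane_iff\<close>)
    have "((\<lambda>z. Im (fst z)) \<longlongrightarrow> Im (fst y)) (at y within S)" by (intro tendsto_intros lims)
    then show "((\<lambda>z. Im (fst z)) \<longlongrightarrow> 0) (at y within S)" using y by simp
  qed
  have fst_le: "cmod (fst z - fst y) \<le> C * Im (fst z)" if "z \<in> S" for z
    using SC[OF that] by (simp add: max_norm_def)
  have ratio1: "hyp_ratio (fst (D z)) (fst z) \<le> Q" if z: "z \<in> S" for z
  proof -
    let ?d = "Im (fst z)"
    have d: "?d > 0" using SB[OF z] by (simp add: biplane_iff)
    have "cmod (fst (D z) - fst z) \<le> cmod (\<i> * of_real ?d) + cmod (fst z - fst y)"
      using norm_triangle_ineq4[of "\<i> * of_real ?d" "fst z - fst y"] by (simp add: D_def algebra_simps)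
    also have "\<dots> \<le> (C + 1) * ?d" using fst_le[OF z] d by (simp add: norm_mult algebra_simps)
    finally have "(cmod (fst (D z) - fst z))\<^sup>2 \<le> ((C + 1) * ?d)\<^sup>2" by (rule power_mono) simp
    then show ?thesis using d y
      by (simp add: hyp_ratio_def D_def Q_def power_mult_distrib pos_divide_le_eq power2_eq_square[of ?d])
  qed
  have ratio2: "\<forall>\<^sub>F z in at y within S. hyp_ratio (snd (D z)) (snd z) < 1"
  proof (rule order_tendstoD(2))
    have "((\<lambda>z. hyp_ratio (snd (D z)) (snd z)) \<longlongrightarrow>
        (cmod (snd y + \<i> * of_real (Im (fst y)) - snd y))\<^sup>2 / (Im (snd y + \<i> * of_real (Im (fst y))) * Im (snd y)))
        (at y within S)"
      unfolding hyp_ratio_def D_def snd_diagonal using y by (intro tendsto_intros lims) auto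
    then show "((\<lambda>z. hyp_ratio (snd (D z)) (snd z)) \<longlongrightarrow> 0) (at y within S)" using y by simp
  qed simp
  have le: "\<forall>\<^sub>F z in at y within S. norm ((fst z - fst y) * g z)
      \<le> C * (Q + 2) * norm (of_real (Im (fst z)) * g (D z))"
    using ratio2 ev_S
  proof eventually_elim
    case (elim z)
    have z: "z \<in> biplane" using SB elim by blast
    then have Dz: "D z \<in> biplane" using y by (simp add: biplane_iff D_def)
    have "(cmod (g (D z) - g z))\<^sup>2 \<le> Q * (Im (g (D z)) * Im (g z))"
      using schwarz_pick[OF g Dz z ratio1] elim Q1 by simp
    then have "cmod (g z) \<le> (Q + 2) * cmod (g (D z))"
      using Q1 Im_nonneg[OF g z] Im_nonneg[OF g Dz] by (intro norm_le_of_schwarz_pick) auto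
    then have "cmod (fst z - fst y) * cmod (g z) \<le> (C * Im (fst z)) * ((Q + 2) * cmod (g (D z)))"
      using fst_le elim z C by (intro mult_mono) (auto simp: biplane_iff)
    then show ?case using z by (simp add: norm_mult biplane_iff mult_ac)
  qed
  have "((\<lambda>z. of_real (Im (fst z)) * g (D z)) \<longlongrightarrow> 0) (at y within S)"
    unfolding D_def using filterlim_compose[OF radial Im_lim] .
  then have "((\<lambda>z. C * (Q + 2) * norm (of_real (Im (fst z)) * g (D z))) \<longlongrightarrow> 0) (at y within S)"
    by (intro tendsto_mult_right_zero tendsto_norm_zero)
  with le show ?thesis by (rule Lim_null_comparison)
qed

text \<open>
  For \<open>\<beta> > 0\<close>, \<open>h\<close> does not take the value \<open>c\<close>, for otherwise it would be constantly real and \<open>\<beta>\<close> would vanish. The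
  nontangential limit is then that of \<open>1 / (1 / \<beta> - (fst z - fst y) * g z)\<close>, with \<open>g\<close> the Julia quotient.
\<close>

lemma difference_quotient_limit:
  assumes h: "h \<in> pick_class2" and y: "Im (fst y) = 0" "Im (snd y) > 0"
    and \<beta>: "B_quotient h y = ereal \<beta>"
    and julia: "\<And>z. z \<in> biplane \<Longrightarrow>
      (cmod (h z - of_real c))\<^sup>2 * Im (fst z) \<le> \<beta> * (cmod (fst z - fst y))\<^sup>2 * Im (h z)"
    and S: "approaches_nontangentially S y"
  shows "((\<lambda>z. (h z - of_real c) / (fst z - fst y)) \<longlongrightarrow> of_real \<beta>) (at y within S)"
proof -
  have \<beta>0: "\<beta> \<ge> 0" using B_quotient_nonneg[OF h, of y] \<beta> by simp
  note julia1 = julia_inequality_bounds(1)[where h=h and c=c, OF _ \<beta>0 julia]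
  have SB: "\<And>z. z \<in> S \<Longrightarrow> z \<in> biplane" using nontangential_bound[OF S] by blast
  have ev_S: "\<forall>\<^sub>F z in at y within S. z \<in> S" by (simp add: eventually_at_filter)
  show ?thesis
  proof (cases "\<beta> = 0")
    case True
    have "h z = of_real c" if "z \<in> biplane" for z
      using julia1[OF that that] that True by (simp add: mult_le_0_iff biplane_iff)
    then have "\<forall>\<^sub>F z in at y within S. (h z - of_real c) / (fst z - fst y) = of_real \<beta>"
      using ev_S SB True by (auto elim: eventually_mono)
    then show ?thesis by (rule tendsto_eventually)
  next
    case False
    then have \<beta>pos: "\<beta> > 0" using \<beta>0 by simp
    have ne: "h z \<noteq> of_real c" if z: "z \<in> biplane" for z
    proof
      assume "h z = of_real c"
      then have "Im (h w) = 0" if "w \<in> biplane" for w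
        using eq_if_real_value[OF h z that] by simp
      then have "B_quotient h y \<le> ereal 0"
        using y by (intro Liminf_le_of_julia_bound) auto
      then show False using \<beta> \<beta>pos by simp
    qed
    let ?g = "julia_quotient h c (fst y) \<beta>"
    have g: "?g \<in> pick_class2"
      using h y(1) \<beta>pos ne julia by (rule julia_quotient_in_pick_class2)
    have radial: "((\<lambda>e. of_real e * ?g (diagonal y e)) \<longlongrightarrow> 0) (at_right 0)"
    proof (rule Lim_transform_eventually)
      let ?u = "\<lambda>e. (h (diagonal y e) - of_real c) / of_real e"
      \<comment> \<open>On the ray, \<open>fst z - fst y = \<i> * e\<close>, so \<open>e * g\<close> is the difference of the reciprocals
        of \<open>\<i> * \<beta>\<close> and of a quantity that tends to it.\<close>
      have "((\<lambda>e. 1 / (\<i> * of_real \<beta>) - 1 / ?u e) \<longlongrightarrow> 1 / (\<i> * of_real \<beta>) - 1 / (\<i> * of_real \<beta>)) (at_right 0)"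
        using y \<beta>pos by (intro tendsto_intros radial_derivative[OF h _ _ \<beta> julia1]) auto
      then show "((\<lambda>e. 1 / (\<i> * of_real \<beta>) - 1 / ?u e) \<longlongrightarrow> 0) (at_right 0)" by simp
      have "1 / (\<i> * of_real \<beta>) - 1 / ?u e = of_real e * ?g (diagonal y e)" if "e > 0" for e
        using that by (simp add: julia_quotient_def field_simps)
      then show "\<forall>\<^sub>F e in at_right 0. 1 / (\<i> * of_real \<beta>) - 1 / ?u e = of_real e * ?g (diagonal y e)"
        by (auto simp: eventually_at_filter)
    qed
    have lim: "((\<lambda>z. (fst z - fst y) * ?g z) \<longlongrightarrow> 0) (at y within S)"
      using g y S radial by (rule residue_limit_nontangential)
    show ?thesis
    proof (rule Lim_transform_eventually)
      have "((\<lambda>z. 1 / (1 / of_real \<beta> - (fst z - fst y) * ?g z)) \<longlongrightarrow> 1 / (1 / of_real \<beta> - 0)) (at y within S)"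
        using \<beta>pos by (intro tendsto_intros lim) auto
      then show "((\<lambda>z. 1 / (1 / of_real \<beta> - (fst z - fst y) * ?g z)) \<longlongrightarrow> of_real \<beta>) (at y within S)"
        by simp
      show "\<forall>\<^sub>F z in at y within S. 1 / (1 / of_real \<beta> - (fst z - fst y) * ?g z) = (h z - of_real c) / (fst z - fst y)"
        using ev_S
      proof eventually_elim
        case (elim z)
        define \<zeta> where "\<zeta> = fst z - fst y"
        have "\<zeta> \<noteq> 0" using SB[OF elim] y by (auto simp: \<zeta>_def biplane_iff)
        then have "1 / of_real \<beta> - \<zeta> * ?g z = \<zeta> / (h z - of_real c)"
          unfolding julia_quotient_def \<zeta>_def[symmetric] by (simp add: algebra_simps)
        then have "1 / of_real \<beta> - (fst z - fst y) * ?g z = (fst z - fst y) / (h z - of_real c)"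
          by (simp add: \<zeta>_def)
        then show ?case by simp
      qed
    qed
  qed
qed

lemma linear_expansion:
  assumes lim: "((\<lambda>z. (h z - of_real c) / (fst z - fst y)) \<longlongrightarrow> of_real \<beta>) (at y within S)"
    and S: "S \<subseteq> biplane" and y: "Im (fst y) = 0"
  shows "linear_expansion_on S h y c (of_real \<beta>, 0)"
  unfolding linear_expansion_on_def
proof (rule landau_o.smallI)
  fix e :: real assume "e > 0"
  then have "\<forall>\<^sub>F z in at y within S. dist ((h z - of_real c) / (fst z - fst y)) (of_real \<beta>) < e"
    using lim by (simp add: tendsto_iff)
  moreover have "\<forall>\<^sub>F z in at y within S. z \<in> S" by (simp add: eventually_at_filter)
  ultimately show "\<forall>\<^sub>F z in at y within S.
      norm (h z - (of_real c + fst (of_real \<beta>, 0) * (fst z - fst y) + snd (of_real \<beta>, 0) * (snd z - snd y)))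
      \<le> e * norm (complex_of_real (max_norm (z - y)))"
  proof eventually_elim
    case (elim z)
    have ne: "fst z - fst y \<noteq> 0" using elim S y by (auto simp: biplane_iff)
    then have "h z - (of_real c + of_real \<beta> * (fst z - fst y))
        = (fst z - fst y) * ((h z - of_real c) / (fst z - fst y) - of_real \<beta>)"
      by (simp add: field_simps)
    then have "norm (h z - (of_real c + of_real \<beta> * (fst z - fst y)))
        = norm (fst z - fst y) * dist ((h z - of_real c) / (fst z - fst y)) (of_real \<beta>)"
      by (simp add: norm_mult dist_norm)
    also have "\<dots> \<le> max_norm (z - y) * e"
      using elim by (intro mult_mono) (auto simp: max_norm_def le_max_iff_disj)
    also have "\<dots> \<le> e * norm (complex_of_real (max_norm (z - y)))"
      using \<open>e > 0\<close> by (simp add: mult.commute)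
    finally show ?case by simp
  qed
qed

theorem theorem4p12:
  fixes h :: "complex \<times> complex \<Rightarrow> complex" and x :: "complex \<times> complex"
  assumes "h \<in> pick_class2"
    and "x \<in> \<real> \<times> upper_half_plane"
    and "B_point h x"
  shows "(\<forall>y \<in> {fst x} \<times> closed_upper_half_plane. B_point h y) \<and>
    (\<forall>y \<in> {fst x} \<times> upper_half_plane. C_point h y) \<and>
    (\<exists>c. \<forall>y \<in> {fst x} \<times> closed_upper_half_plane. has_nontangential_limit h y c) \<and>
    (\<exists>\<beta>::real.
       ereal \<beta> = Liminf (at x within biplane) (\<lambda>z. ereal (Im (h z) / Im (fst z))) \<and>
       (\<forall>y \<in> {fst x} \<times> upper_half_plane. has_angular_gradient h y (of_real \<beta>, 0)))"
proof -
  note h = assms(1)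
  have x: "Im (fst x) = 0" "Im (snd x) > 0"
    using assms(2) by (auto simp: upper_half_plane_def mem_Times_iff complex_is_Real_iff)
  have "B_quotient h x < \<infinity>" using assms(3) by (simp add: B_point_def B_quotient_def)
  then obtain \<beta> where \<beta>: "B_quotient h x = ereal \<beta>" and \<beta>0: "\<beta> \<ge> 0"
    using B_quotient_nonneg[OF h, of x] by (cases "B_quotient h x") auto
  obtain c :: real where julia: "\<And>z. z \<in> biplane \<Longrightarrow>
      (cmod (h z - of_real c))\<^sup>2 * Im (fst z) \<le> \<beta> * (cmod (fst z - fst x))\<^sup>2 * Im (h z)"
    using julia_inequality[OF h x] \<beta> by (metis order_refl)
  note bounds = julia_inequality_bounds[where h=h and c=c, OF _ \<beta>0 julia]
  have B: "B_point h y" if "y \<in> {fst x} \<times> closed_upper_half_plane" for y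
  proof -
    have y: "Im (fst y) = 0" "Im (snd y) \<ge> 0" "fst y = fst x"
      using that x by (auto simp: closed_upper_half_plane_def)
    have "B_quotient h y \<le> ereal \<beta>"
      "Liminf (at y within biplane) (\<lambda>z. ereal (Im (h z) / Im (snd z))) \<le> ereal \<beta>"
      using bounds(2) y \<beta>0 by (auto intro!: Liminf_le_of_julia_bound)
    then show ?thesis unfolding B_point_def B_quotient_def
      using frontier_biplaneI[OF y(1,2)] by (auto elim: order.strict_trans1)
  qed
  have lim: "has_nontangential_limit h y (of_real c)" if "y \<in> {fst x} \<times> closed_upper_half_plane" for y
    using that x bounds(1) \<beta>0
    by (intro nontangential_limit[of _ \<beta>]) (auto simp: closed_upper_half_plane_def)
  have expansion: "linear_expansion_on S h y c (of_real \<beta>, 0)"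
    if y: "y \<in> {fst x} \<times> upper_half_plane" and S: "approaches_nontangentially S y" for y S
  proof -
    have y': "Im (fst y) = 0" "Im (snd y) > 0" "fst y = fst x"
      using y x by (auto simp: upper_half_plane_def)
    have "B_quotient h y \<le> B_quotient h x"
      using h x y'(2,3) \<beta> by (rule B_quotient_le_of_same_fst)
    moreover obtain \<gamma> where \<gamma>: "B_quotient h y = ereal \<gamma>"
      using calculation B_quotient_nonneg[OF h, of y] \<beta> by (cases "B_quotient h y") auto
    have "B_quotient h x \<le> B_quotient h y"
      using h y'(1,2) x(2) y'(3)[symmetric] \<gamma> by (rule B_quotient_le_of_same_fst)
    ultimately have "B_quotient h y = ereal \<beta>" using \<beta> by simp
    then have "((\<lambda>z. (h z - of_real c) / (fst z - fst y)) \<longlongrightarrow> of_real \<beta>) (at y within S)"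
      using h y' S julia by (intro difference_quotient_limit) auto
    then show ?thesis
      using S y'(1) by (intro linear_expansion) (auto simp: approaches_nontangentially_def)
  qed
  have C: "C_point h y" if "y \<in> {fst x} \<times> upper_half_plane" for y
    unfolding C_point_def
  proof (intro conjI allI impI exI)
    show "y \<in> frontier biplane"
      using that x by (intro frontier_biplaneI) (auto simp: upper_half_plane_def)
    show "linear_expansion_on S h y c (of_real \<beta>, 0)" if "approaches_nontangentially S y" for S
      using expansion[OF \<open>y \<in> {fst x} \<times> upper_half_plane\<close> that] .
  qed
  have "ereal \<beta> = Liminf (at x within biplane) (\<lambda>z. ereal (Im (h z) / Im (fst z)))"
    using \<beta> by (simp add: B_quotient_def)
  then show ?thesis
    using B C lim expansion unfolding has_angular_gradient_def by blast
qed

end
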